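(* $\cong_{\mathcal{CM}_1}\ \equiv_c\ E_{\min}$.
   Context: $W_e$ denotes the $e$-th c.e. set. $\mathcal{CM}$ is the variety of commutative monoids (binary operation and identity constant). Fix a computable bijective coding of pairs of terms over the single generator $x_0$ by natural numbers; $\mathcal{CM}_1[e]$ is the term algebra over $\{x_0\}$ modulo the smallest congruence containing the pairs coded in $W_e$ and all instances of the commutative monoid laws, and $e\cong_{\mathcal{CM}_1}i$ iff $\mathcal{CM}_1[e]\cong\mathcal{CM}_1[i]$. $e\,E_{\min}\,i$ iff $\min W_e=\min W_i$ or $W_e=W_i=\emptyset$. For equivalence relations $E,F$ on $\mathbb N$, $E\le_c F$ means there is a total computable $h$ with $x\,E\,y\iff h(x)\,F\,h(y)$; $E\equiv_c F$ means $E\le_c F$ and $F\le_c E$. *)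

theory Defs
  imports "HOL-Library.Nat_Bijection" "HOL-Algebra.Group"
begin

text \<open>
  Partial recursive functions, in the unary presentation: arguments and results are single
  natural numbers, and tuples are passed through the Cantor pairing \<^const>\<open>prod_encode\<close>.
\<close>

datatype prog =
    Zero | Succ | Fst | Snd
  | Tuple prog prog
  | Comp prog prog
  | PrimRec prog prog
  | Mu prog

text \<open>
  In the \<^const>\<open>Mu\<close> clause, \<open>f\<close> must be defined (and positive) at all arguments
  below the zero that is found, so the zero is unique and \<open>THE\<close> is well defined.
\<close>

primrec eval :: "prog \<Rightarrow> nat \<Rightarrow> nat option" where
  "eval Zero x = Some 0"
| "eval Succ x = Some (Suc x)"
| "eval Fst x = Some (fst (prod_decode x))"
| "eval Snd x = Some (snd (prod_decode x))"
| "eval (Tuple f g) x =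
     Option.bind (eval f x) (\<lambda>a. Option.bind (eval g x) (\<lambda>b. Some (prod_encode (a, b))))"
| "eval (Comp f g) x = Option.bind (eval g x) (eval f)"
| "eval (PrimRec f g) x =
     (let a = fst (prod_decode x); n = snd (prod_decode x) in
      rec_nat (eval f a)
        (\<lambda>m r. Option.bind r (\<lambda>v. eval g (prod_encode (a, prod_encode (m, v))))) n)"
| "eval (Mu f) x =
     (let Q = (\<lambda>n. eval f (prod_encode (x, n)) = Some 0 \<and>
                   (\<forall>m<n. \<exists>v. eval f (prod_encode (x, m)) = Some (Suc v))) in
      if \<exists>n. Q n then Some (THE n. Q n) else None)"

definition computable :: "(nat \<Rightarrow> nat) \<Rightarrow> bool" where
  "computable h \<longleftrightarrow> (\<exists>p. \<forall>x. eval p x = Some (h x))"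

primrec prog_encode :: "prog \<Rightarrow> nat" where
  "prog_encode Zero = 0"
| "prog_encode Succ = 1"
| "prog_encode Fst = 2"
| "prog_encode Snd = 3"
| "prog_encode (Tuple f g) = 4 * prod_encode (prog_encode f, prog_encode g) + 4"
| "prog_encode (Comp f g) = 4 * prod_encode (prog_encode f, prog_encode g) + 5"
| "prog_encode (PrimRec f g) = 4 * prod_encode (prog_encode f, prog_encode g) + 6"
| "prog_encode (Mu f) = 4 * prog_encode f + 7"

lemma prog_encode_inject: "prog_encode p = prog_encode q \<Longrightarrow> p = q"
proof (induction p arbitrary: q)
  case Zero then show ?case by (cases q) auto
next
  case Succ then show ?case by (cases q) auto
next
  case Fst then show ?case by (cases q) auto
next
  case Snd then show ?case by (cases q) auto
next
  case (Tuple f g) then show ?case by (cases q) (auto, presburger+)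
next
  case (Comp f g) then show ?case by (cases q) (auto, presburger+)
next
  case (PrimRec f g) then show ?case by (cases q) (auto, presburger+)
next
  case (Mu f) then show ?case by (cases q) (auto, presburger+)
qed

lemma prog_encode_surj: "\<exists>p. prog_encode p = n"
proof (induction n rule: less_induct)
  case (less n)
  show ?case
  proof (cases "n < 4")
    case True
    then consider "n = 0" | "n = 1" | "n = 2" | "n = 3" by linarith
    then show ?thesis
      by cases (metis prog_encode.simps(1), metis prog_encode.simps(2),
                metis prog_encode.simps(3), metis prog_encode.simps(4))
  next
    case False
    define k where "k = (n - 4) div 4"
    obtain a b where ab: "k = prod_encode (a, b)"
      by (metis prod_decode_inverse surj_pair)
    have "k < n" using False by (simp add: k_def)
    moreover have "a \<le> k" "b \<le> k"
      using ab le_prod_encode_1 le_prod_encode_2 by auto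
    ultimately obtain p q r where
      pqr: "prog_encode p = a" "prog_encode q = b" "prog_encode r = k"
      using less.IH by (meson le_less_trans)
    have "n = 4 * k + 4 \<or> n = 4 * k + 5 \<or> n = 4 * k + 6 \<or> n = 4 * k + 7"
      using False unfolding k_def by presburger
    then show ?thesis
      using pqr ab prog_encode.simps(5-8) by metis
  qed
qed

lemma bij_prog_encode: "bij prog_encode"
  by (metis bijI injI prog_encode_inject prog_encode_surj surjI)

definition W :: "nat \<Rightarrow> nat set" where
  "W e = {x. eval (inv_into UNIV prog_encode e) x \<noteq> None}"

definition E_min :: "nat \<Rightarrow> nat \<Rightarrow> bool" where
  "E_min e i \<longleftrightarrow>
     (W e = {} \<and> W i = {}) \<or>
     (W e \<noteq> {} \<and> W i \<noteq> {} \<and> (LEAST x. x \<in> W e) = (LEAST x. x \<in> W i))"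

definition reducible_c :: "(nat \<Rightarrow> nat \<Rightarrow> bool) \<Rightarrow> (nat \<Rightarrow> nat \<Rightarrow> bool) \<Rightarrow> bool"
    (infix "\<le>\<^sub>c" 50) where
  "E \<le>\<^sub>c F \<longleftrightarrow> (\<exists>h. computable h \<and> (\<forall>x y. E x y \<longleftrightarrow> F (h x) (h y)))"

definition bireducible_c :: "(nat \<Rightarrow> nat \<Rightarrow> bool) \<Rightarrow> (nat \<Rightarrow> nat \<Rightarrow> bool) \<Rightarrow> bool"
    (infix "\<equiv>\<^sub>c" 50) where
  "E \<equiv>\<^sub>c F \<longleftrightarrow> E \<le>\<^sub>c F \<and> F \<le>\<^sub>c E"

datatype trm = X0 | Unit | Mult trm trm

primrec trm_encode :: "trm \<Rightarrow> nat" where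
  "trm_encode X0 = 0"
| "trm_encode Unit = 1"
| "trm_encode (Mult s t) = prod_encode (trm_encode s, trm_encode t) + 2"

lemma trm_encode_inject: "trm_encode s = trm_encode t \<Longrightarrow> s = t"
proof (induction s arbitrary: t)
  case X0 then show ?case by (cases t) auto
next
  case Unit then show ?case by (cases t) auto
next
  case (Mult u v) then show ?case by (cases t) auto
qed

lemma trm_encode_surj: "\<exists>t. trm_encode t = n"
proof (induction n rule: less_induct)
  case (less n)
  show ?case
  proof (cases "n < 2")
    case True
    then consider "n = 0" | "n = 1" by linarith
    then show ?thesis
      by cases (metis trm_encode.simps(1), metis trm_encode.simps(2))
  next
    case False
    define k where "k = n - 2"
    obtain a b where ab: "k = prod_encode (a, b)"
      by (metis prod_decode_inverse surj_pair)
    have n: "n = k + 2" using False by (simp add: k_def)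
    moreover have "a \<le> k" "b \<le> k"
      using ab le_prod_encode_1 le_prod_encode_2 by auto
    ultimately have "a < n" "b < n" by auto
    then obtain s t where "trm_encode s = a" "trm_encode t = b"
      using less.IH by meson
    then have "trm_encode (Mult s t) = n" using ab n by simp
    then show ?thesis ..
  qed
qed

lemma bij_trm_encode: "bij trm_encode"
  by (metis bijI injI trm_encode_inject trm_encode_surj surjI)

text \<open>
  A bijective coding \<open>d\<close> of pairs of terms by numbers is computable if the pair \<open>d n\<close>,
  written out as a syntactic object, can be computed from \<open>n\<close>.  Syntactic objects are
  represented by the structural numbering \<^const>\<open>trm_encode\<close>.  As \<open>d\<close> is bijective, the
  passage back from pairs of terms to codes is then computable as well.
\<close>

definition computable_coding :: "(nat \<Rightarrow> trm \<times> trm) \<Rightarrow> bool" where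
  "computable_coding d \<longleftrightarrow>
     bij d \<and> computable (\<lambda>n. prod_encode (map_prod trm_encode trm_encode (d n)))"

lemma computable_coding_standard:
  "computable_coding (map_prod (inv_into UNIV trm_encode) (inv_into UNIV trm_encode) \<circ> prod_decode)"
proof -
  have b: "bij (inv_into UNIV trm_encode)"
    by (rule bij_imp_bij_inv[OF bij_trm_encode])
  have "bij (map_prod (inv_into UNIV trm_encode) (inv_into UNIV trm_encode))"
    using bij_betw_map_prod[OF b b] by simp
  then have "bij (map_prod (inv_into UNIV trm_encode) (inv_into UNIV trm_encode) \<circ> prod_decode)"
    by (rule bij_comp[OF bij_prod_decode])
  moreover have "prod_encode (map_prod trm_encode trm_encode
      ((map_prod (inv_into UNIV trm_encode) (inv_into UNIV trm_encode) \<circ> prod_decode) n)) = n" for n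
    using surj_f_inv_f[OF bij_is_surj[OF bij_trm_encode]]
    by (cases "prod_decode n") (simp, metis prod_decode_inverse)
  moreover have "computable (\<lambda>n. n)"
    unfolding computable_def by (rule exI[of _ "Tuple Fst Snd"]) simp
  ultimately show ?thesis by (simp add: computable_coding_def)
qed

inductive_set gen_cong :: "(trm \<times> trm) set \<Rightarrow> (trm \<times> trm) set"
  for R :: "(trm \<times> trm) set"
where
  base: "p \<in> R \<Longrightarrow> p \<in> gen_cong R"
| refl: "(s, s) \<in> gen_cong R"
| sym: "(s, t) \<in> gen_cong R \<Longrightarrow> (t, s) \<in> gen_cong R"
| trans: "(s, t) \<in> gen_cong R \<Longrightarrow> (t, u) \<in> gen_cong R \<Longrightarrow> (s, u) \<in> gen_cong R"
| mult: "(s, s') \<in> gen_cong R \<Longrightarrow> (t, t') \<in> gen_cong R \<Longrightarrow>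
    (Mult s t, Mult s' t') \<in> gen_cong R"

definition comm_monoid_laws :: "(trm \<times> trm) set" where
  "comm_monoid_laws =
     {(Mult (Mult s t) u, Mult s (Mult t u)) | s t u. True} \<union>
     {(Mult s t, Mult t s) | s t. True} \<union>
     {(Mult Unit s, s) | s. True} \<union>
     {(Mult s Unit, s) | s. True}"

definition CM1_cong :: "(nat \<Rightarrow> trm \<times> trm) \<Rightarrow> nat \<Rightarrow> (trm \<times> trm) set" where
  "CM1_cong d e = gen_cong (d ` W e \<union> comm_monoid_laws)"

definition CM1 :: "(nat \<Rightarrow> trm \<times> trm) \<Rightarrow> nat \<Rightarrow> trm set monoid" where
  "CM1 d e = \<lparr>
     carrier = UNIV // CM1_cong d e,
     mult = (\<lambda>A B. \<Union>s\<in>A. \<Union>t\<in>B. CM1_cong d e `` {Mult s t}),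
     one = CM1_cong d e `` {Unit} \<rparr>"

lemma equiv_CM1_cong: "equiv UNIV (CM1_cong d e)"
  unfolding CM1_cong_def
  by (intro equivI refl_onI symI transI) (auto intro: gen_cong.intros)

lemma CM1_mult_class:
  "CM1_cong d e `` {s} \<otimes>\<^bsub>CM1 d e\<^esub> CM1_cong d e `` {t} = CM1_cong d e `` {Mult s t}"
proof -
  have "congruent2 (CM1_cong d e) (CM1_cong d e) (\<lambda>s t. CM1_cong d e `` {Mult s t})"
  proof (rule congruent2I')
    fix s s' t t'
    assume "(s, s') \<in> CM1_cong d e" "(t, t') \<in> CM1_cong d e"
    then have "(Mult s t, Mult s' t') \<in> CM1_cong d e"
      unfolding CM1_cong_def by (rule gen_cong.mult)
    then show "CM1_cong d e `` {Mult s t} = CM1_cong d e `` {Mult s' t'}"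
      by (rule equiv_class_eq[OF equiv_CM1_cong])
  qed
  from UN_equiv_class2[OF equiv_CM1_cong equiv_CM1_cong this]
  show ?thesis by (simp add: CM1_def)
qed

text \<open>
  \<^const>\<open>iso\<close> only asks for compatibility with multiplication, hence the separate
  condition on the identity constant of the signature.
\<close>

definition iso_CM1 :: "(nat \<Rightarrow> trm \<times> trm) \<Rightarrow> nat \<Rightarrow> nat \<Rightarrow> bool" where
  "iso_CM1 d e i \<longleftrightarrow>
     (\<exists>f \<in> iso (CM1 d e) (CM1 d i). f \<one>\<^bsub>CM1 d e\<^esub> = \<one>\<^bsub>CM1 d i\<^esub>)"

end

theory Submission
  imports Defs
begin

text \<open>
  A congruence on the free commutative monoid \<open>{x\<^sup>n | n}\<close> is either equality or the one of the cyclic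
  monoid of index \<open>a\<close> and period \<open>g > 0\<close>, where for a given generating set of pairs
  \<open>(x\<^sup>m, x\<^sup>n)\<close> the index is the least \<open>min m n\<close> over the pairs with \<open>m \<noteq> n\<close> and the period is
  the gcd of all \<open>\<bar>m - n\<bar>\<close>. The congruence is an isomorphism invariant of the quotient, because
  \<open>x\<^sup>m = x\<^sup>n\<close> holds iff \<open>z\<^sup>m = z\<^sup>n\<close> for all elements \<open>z\<close>. While the generators are being
  enumerated, \<open>a\<close> decreases and \<open>g\<close> is replaced by divisors, so that enumerating the Cantor codes of
  all approximations \<open>(a, g)\<close> yields a c.e. set whose minimum, if any, is the code of the true pair.
  Conversely, the relations \<open>x\<^sup>m = x\<^bsup>m+1\<^esup>\<close> for \<open>m \<in> W\<^sub>e\<close> present the cyclic monoid of index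
  \<open>min W\<^sub>e\<close> and period 1. Uniformity in \<open>e\<close> rests on a fuel-bounded total interpreter, whose
  computability is shown by course-of-values recursion on program codes.
\<close>

section \<open>Closure properties of the computable functions\<close>

abbreviation pfst :: "nat \<Rightarrow> nat" where "pfst z \<equiv> fst (prod_decode z)"
abbreviation psnd :: "nat \<Rightarrow> nat" where "psnd z \<equiv> snd (prod_decode z)"

text \<open>Truth is coded by 0, as this is the value that \<^const>\<open>Mu\<close> searches for.\<close>

definition decidable :: "(nat \<Rightarrow> bool) \<Rightarrow> bool" where
  "decidable P \<longleftrightarrow> computable (\<lambda>x. if P x then 0 else 1)"

named_theorems computable_intros

lemma computableI: "(\<And>x. eval p x = Some (h x)) \<Longrightarrow> computable h"
  unfolding computable_def by blast

lemma computableE: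
  assumes "computable h"
  obtains p where "\<And>x. eval p x = Some (h x)"
  using assms unfolding computable_def by blast

lemma computable_id [computable_intros]: "computable (\<lambda>x. x)"
  by (rule computableI[of "Tuple Fst Snd"]) simp

lemma computable_comp:
  assumes "computable g" "computable f"
  shows "computable (\<lambda>x. g (f x))"
proof -
  from assms obtain p q where "\<And>x. eval p x = Some (g x)" "\<And>x. eval q x = Some (f x)"
    by (metis computableE)
  then show ?thesis by (intro computableI[of "Comp p q"]) simp
qed

lemma computable_Suc [computable_intros]: "computable f \<Longrightarrow> computable (\<lambda>x. Suc (f x))"
  by (rule computable_comp[of Suc]) (rule computableI[of Succ], simp)

lemma computable_fst [computable_intros]: "computable f \<Longrightarrow> computable (\<lambda>x. pfst (f x))"
  by (rule computable_comp[of pfst]) (rule computableI[of Fst], simp)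

lemma computable_snd [computable_intros]: "computable f \<Longrightarrow> computable (\<lambda>x. psnd (f x))"
  by (rule computable_comp[of psnd]) (rule computableI[of Snd], simp)

lemma computable_pair [computable_intros]:
  assumes "computable f" "computable g"
  shows "computable (\<lambda>x. prod_encode (f x, g x))"
proof -
  from assms obtain p q where "\<And>x. eval p x = Some (f x)" "\<And>x. eval q x = Some (g x)"
    by (metis computableE)
  then show ?thesis by (intro computableI[of "Tuple p q"]) simp
qed

text \<open>Substitution for binary functions: these are written in curried form, while
  computability only speaks of unary functions of a Cantor code.\<close>

lemma computable_comp2:
  assumes "computable (\<lambda>z. g (pfst z) (psnd z))" "computable a" "computable b"
  shows "computable (\<lambda>x. g (a x) (b x))"
  using computable_comp[OF assms(1) computable_pair[OF assms(2,3)]] by simp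

lemma computable_comp3:
  assumes "computable (\<lambda>z. g (pfst z) (pfst (psnd z)) (psnd (psnd z)))"
    and "computable a" "computable b" "computable c"
  shows "computable (\<lambda>x. g (a x) (b x) (c x))"
  using computable_comp[OF assms(1) computable_pair[OF assms(2) computable_pair[OF assms(3,4)]]]
  by simp

lemma computable_const [computable_intros]: "computable (\<lambda>x. c)"
proof (induction c)
  case 0
  show ?case by (rule computableI[of Zero]) simp
next
  case (Suc c)
  then show ?case by (rule computable_Suc)
qed

text \<open>The step function may depend on the parameter \<open>x\<close>, because
  \<open>PrimRec\<close> passes the parameter along at every step.\<close>

lemma computable_rec [computable_intros]:
  assumes f: "computable f" and n: "computable n"
    and g: "computable (\<lambda>z. g (pfst z) (pfst (psnd z)) (psnd (psnd z)))"
  shows "computable (\<lambda>x. rec_nat (f x) (g x) (n x))"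
proof -
  from f obtain p where p: "\<And>x. eval p x = Some (f x)"
    by (rule computableE) blast
  from g obtain q where q: "\<And>z. eval q z = Some (g (pfst z) (pfst (psnd z)) (psnd (psnd z)))"
    by (rule computableE) blast
  have "rec_nat (eval p x)
      (\<lambda>m r. Option.bind r (\<lambda>v. eval q (prod_encode (x, prod_encode (m, v))))) k
      = Some (rec_nat (f x) (g x) k)" for x k
    by (induction k) (simp_all add: p q)
  then have "computable (\<lambda>z. rec_nat (f (pfst z)) (g (pfst z)) (psnd z))"
    by (intro computableI[of "PrimRec p q"]) (simp add: Let_def)
  from computable_comp2[where g = "\<lambda>x. rec_nat (f x) (g x)", OF this computable_id n]
  show ?thesis .
qed

text \<open>Eliminates \<open>THE\<close>: of two distinct candidates, the smaller one would have to
  give both zero and a successor.\<close>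

lemma eval_Mu_eq_Some_iff:
  "eval (Mu f) x = Some n \<longleftrightarrow> eval f (prod_encode (x, n)) = Some 0 \<and>
     (\<forall>m<n. \<exists>v. eval f (prod_encode (x, m)) = Some (Suc v))"
proof -
  define Q where "Q = (\<lambda>n. eval f (prod_encode (x, n)) = Some 0 \<and>
     (\<forall>m<n. \<exists>v. eval f (prod_encode (x, m)) = Some (Suc v)))"
  have eval_Mu: "eval (Mu f) x = (if \<exists>n. Q n then Some (THE n. Q n) else None)"
    by (simp add: Q_def Let_def)
  have "\<not> a < b" if "Q a" "Q b" for a b
    using that by (fastforce simp: Q_def)
  then have uniq: "a = b" if "Q a" "Q b" for a b
    using that by (meson nat_neq_iff)
  have "eval (Mu f) x = Some n \<longleftrightarrow> Q n"
  proof (cases "\<exists>n. Q n")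
    case True
    then obtain k where k: "Q k" by blast
    then have "(THE n. Q n) = k" using uniq by (intro the_equality) blast+
    with True have "eval (Mu f) x = Some k" by (simp only: eval_Mu if_True)
    then show ?thesis using k uniq by auto
  next
    case False
    then show ?thesis by (simp only: eval_Mu if_False) auto
  qed
  then show ?thesis by (simp only: Q_def)
qed

text \<open>The assumption \<open>ex\<close> makes the unbounded search total; the test value 1 for
  falsity is the positive value that lets \<open>Mu\<close> go on.\<close>

lemma computable_Least [computable_intros]:
  assumes P: "decidable (\<lambda>z. P (pfst z) (psnd z))" and ex: "\<And>x. \<exists>n. P x n"
  shows "computable (\<lambda>x. LEAST n. P x n)"
proof -
  obtain p where p: "\<And>z. eval p z = Some (if P (pfst z) (psnd z) then 0 else 1)"
    using P unfolding decidable_def by (rule computableE) blast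
  have "eval (Mu p) x = Some (LEAST n. P x n)" for x
    unfolding eval_Mu_eq_Some_iff p prod_encode_inverse fst_conv snd_conv
    by (metis LeastI_ex[OF ex] not_less_Least One_nat_def)
  then show ?thesis by (rule computableI)
qed

lemma computable_if [computable_intros]:
  assumes "decidable P" "computable f" "computable g"
  shows "computable (\<lambda>x. if P x then f x else g x)"
proof -
  \<comment> \<open>The truth value serves as the recursion depth: no step leaves
    \<open>f x\<close>, one step replaces it by \<open>g x\<close>.\<close>
  have "computable (\<lambda>x. rec_nat (f x) (\<lambda>_ _. g x) (if P x then 0 else 1))"
    using assms(1) unfolding decidable_def
    by (intro computable_rec assms computable_comp[OF assms(3)] computable_intros)
  moreover have "rec_nat (f x) (\<lambda>_ _. g x) (if P x then 0 else 1) = (if P x then f x else g x)" for x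
    by simp
  ultimately show ?thesis by simp
qed

section \<open>Arithmetic functions and decidable relations\<close>

lemma computable_add [computable_intros]:
  assumes "computable f" "computable g"
  shows "computable (\<lambda>x. f x + g x)"
proof -
  have "computable (\<lambda>x. rec_nat (f x) (\<lambda>_ v. Suc v) (g x))"
    by (intro computable_intros assms)
  moreover have "rec_nat a (\<lambda>_ v. Suc v) b = a + b" for a b by (induction b) simp_all
  ultimately show ?thesis by simp
qed

lemma computable_diff [computable_intros]:
  assumes "computable f" "computable g"
  shows "computable (\<lambda>x. f x - g x)"
proof -
  \<comment> \<open>The inner recursion is the predecessor function.\<close>
  have "computable (\<lambda>x. rec_nat (f x) (\<lambda>_ v. rec_nat 0 (\<lambda>m _. m) v) (g x))"
    by (intro computable_intros assms)
  moreover have "rec_nat 0 (\<lambda>m _. m) v = v - 1" for v :: nat by (cases v) simp_all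
  then have "rec_nat a (\<lambda>_ v. rec_nat 0 (\<lambda>m _. m) v) b = a - b" for a b :: nat
    by (induction b) simp_all
  ultimately show ?thesis by simp
qed

lemma computable_mult [computable_intros]:
  assumes "computable f" "computable g"
  shows "computable (\<lambda>x. f x * g x)"
proof -
  have "computable (\<lambda>x. rec_nat 0 (\<lambda>_ v. v + f x) (g x))"
    by (intro computable_intros assms computable_comp[OF assms(1)])
  moreover have "rec_nat 0 (\<lambda>_ v. v + a) b = a * b" for a b :: nat by (induction b) simp_all
  ultimately show ?thesis by simp
qed

lemma decidableI:
  assumes "computable f" "\<And>x. P x \<longleftrightarrow> f x = 0"
  shows "decidable P"
proof -
  \<comment> \<open>Double truncated subtraction sends 0 to 0 and every positive value to 1.\<close>
  have "computable (\<lambda>x. 1 - (1 - f x))"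
    by (intro computable_intros assms)
  moreover have "1 - (1 - f x) = (if P x then 0 else 1)" for x
    using assms(2) by simp
  ultimately show ?thesis by (simp add: decidable_def)
qed

lemma decidable_le [computable_intros]:
  "computable f \<Longrightarrow> computable g \<Longrightarrow> decidable (\<lambda>x. f x \<le> g x)"
  by (rule decidableI[of "\<lambda>x. f x - g x"]) (auto intro: computable_intros)

lemma decidable_less [computable_intros]:
  "computable f \<Longrightarrow> computable g \<Longrightarrow> decidable (\<lambda>x. f x < g x)"
  by (rule decidableI[of "\<lambda>x. Suc (f x) - g x"]) (auto intro: computable_intros)

lemma decidable_conj [computable_intros]:
  assumes "decidable P" "decidable Q"
  shows "decidable (\<lambda>x. P x \<and> Q x)"
  by (rule decidableI[of "\<lambda>x. (if P x then 0 else 1) + (if Q x then 0 else 1)"], intro computable_intros assms)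
    auto

lemma decidable_not [computable_intros]:
  assumes "decidable P"
  shows "decidable (\<lambda>x. \<not> P x)"
  by (rule decidableI[of "\<lambda>x. if P x then 1 else 0"], intro computable_intros assms) auto

lemma decidable_eq [computable_intros]:
  assumes "computable f" "computable g"
  shows "decidable (\<lambda>x. f x = g x)"
  unfolding order_eq_iff by (intro computable_intros assms)

lemma decidable_disj [computable_intros]:
  assumes "decidable P" "decidable Q"
  shows "decidable (\<lambda>x. P x \<or> Q x)"
  by (rule decidableI[of "\<lambda>x. (if P x then 0 else 1) * (if Q x then 0 else 1)"], intro computable_intros assms)
    auto

lemma computable_div [computable_intros]:
  assumes "computable f" "computable g"
  shows "computable (\<lambda>x. f x div g x)"
proof -
  \<comment> \<open>The disjunct \<open>g x = 0\<close> keeps the search total in the case that the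
    conditional discards.\<close>
  have "computable (\<lambda>x. if g x = 0 then 0 else LEAST q. g x = 0 \<or> f x < Suc q * g x)"
  proof (intro computable_intros assms computable_comp[OF assms(1)] computable_comp[OF assms(2)])
    fix x
    show "\<exists>q. g x = 0 \<or> f x < Suc q * g x"
      by (metis dividend_less_times_div mult.commute mult_Suc_right not_gr_zero)
  qed
  moreover have "(if b = 0 then 0 else LEAST q. b = 0 \<or> a < Suc q * b) = a div b" for a b :: nat
  proof (cases "b = 0")
    case False
    have "(LEAST q. b = 0 \<or> a < Suc q * b) = a div b"
    proof (rule Least_equality)
      show "b = 0 \<or> a < Suc (a div b) * b"
        by (metis dividend_less_times_div mult.commute mult_Suc_right not_gr_zero)
      show "a div b \<le> q" if "b = 0 \<or> a < Suc q * b" for q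
        using that False by (simp add: div_less_iff_less_mult flip: less_Suc_eq_le)
    qed
    with False show ?thesis by simp
  qed simp
  ultimately show ?thesis by simp
qed

lemma computable_mod [computable_intros]:
  assumes "computable f" "computable g"
  shows "computable (\<lambda>x. f x mod g x)"
  unfolding minus_div_mult_eq_mod[symmetric] by (intro computable_intros assms)

lemma decidable_dvd [computable_intros]:
  assumes "computable f" "computable g"
  shows "decidable (\<lambda>x. f x dvd g x)"
  unfolding dvd_eq_mod_eq_0 by (intro computable_intros assms)

lemma computable_min [computable_intros]:
  assumes "computable f" "computable g"
  shows "computable (\<lambda>x. min (f x) (g x))"
  unfolding min_def by (intro computable_intros assms)

lemma computable_gcd [computable_intros]:
  assumes "computable f" "computable g"
  shows "computable (\<lambda>x. gcd (f x) (g x))"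
proof -
  \<comment> \<open>Common divisors are tried downwards from \<open>a + b\<close>, so the least
    successful \<open>j\<close> yields the greatest one.\<close>
  define P where "P = (\<lambda>a b j :: nat. a + b - j dvd a \<and> a + b - j dvd b)"
  have gcd_le: "gcd a b \<le> a + b" for a b :: nat
    by (cases "a = 0") (simp_all add: gcd_le1_nat trans_le_add1)
  then have P_gcd: "P a b (a + b - gcd a b)" for a b
    by (simp add: P_def)
  have "computable (\<lambda>x. f x + g x - (LEAST j. P (f x) (g x) j))"
    using P_gcd unfolding P_def
    by (intro computable_intros assms computable_comp[OF assms(1)] computable_comp[OF assms(2)]) blast+
  moreover have "a + b - (LEAST j. P a b j) = gcd a b" for a b
  proof (cases "a + b = 0")
    case False
    have "(LEAST j. P a b j) = a + b - gcd a b"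
    proof (rule Least_equality)
      fix j assume "P a b j"
      then have "a + b - j dvd gcd a b" by (simp add: P_def)
      then have "a + b - j \<le> gcd a b" using False by (intro dvd_imp_le) auto
      then show "a + b - gcd a b \<le> j" by linarith
    qed (rule P_gcd)
    with gcd_le[of a b] show ?thesis by simp
  qed simp
  ultimately show ?thesis by simp
qed

section \<open>Course-of-values recursion\<close>

text \<open>The history of \<open>F\<close> below \<open>k\<close> as a nested pair, with the latest
  value outermost.\<close>

definition tab :: "(nat \<Rightarrow> nat) \<Rightarrow> nat \<Rightarrow> nat" where
  "tab F k = rec_nat 0 (\<lambda>m c. prod_encode (F m, c)) k"

text \<open>Entry \<open>x\<close> lies below \<open>k - Suc x\<close> later entries. The default 0
  outside the table will stand for an undefined result.\<close>

definition look :: "nat \<Rightarrow> nat \<Rightarrow> nat \<Rightarrow> nat" where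
  "look k c x = (if x < k then pfst (rec_nat c (\<lambda>_ v. psnd v) (k - Suc x)) else 0)"

lemma tab_simps [simp]: "tab F 0 = 0" "tab F (Suc m) = prod_encode (F m, tab F m)"
  by (simp_all add: tab_def)

lemma look_tab: "look k (tab F k) x = (if x < k then F x else 0)"
proof -
  have "rec_nat (tab F (x + j)) (\<lambda>_ v. psnd v) j = tab F x" for x j
  proof (induction j arbitrary: x)
    case (Suc j)
    from Suc[of "Suc x"] show ?case by simp
  qed simp
  then have "rec_nat (tab F k) (\<lambda>_ v. psnd v) (k - Suc x) = tab F (Suc x)" if "x < k"
    using that by (metis Suc_leI le_add_diff_inverse)
  then show ?thesis by (simp add: look_def)
qed

lemma computable_look [computable_intros]:
  assumes "computable k" "computable c" "computable a"
  shows "computable (\<lambda>x. look (k x) (c x) (a x))"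
  unfolding look_def by (intro computable_intros assms)

lemma computable_tab [computable_intros]:
  assumes "computable (\<lambda>z. F (pfst z) (psnd z))" "computable k"
  shows "computable (\<lambda>x. tab (F x) (k x))"
  unfolding tab_def by (intro computable_intros assms computable_comp2[OF assms(1)])

text \<open>The history of \<open>H y\<close> is itself given by ordinary primitive recursion, each
  step applying \<open>G\<close> to the history so far.\<close>

lemma computable_course_of_values:
  assumes G: "computable (\<lambda>z. G (pfst z) (pfst (psnd z)) (psnd (psnd z)))"
    and H: "\<And>y m. H y m = G y m (tab (H y) m)"
    and a: "computable a" and b: "computable b"
  shows "computable (\<lambda>x. H (a x) (b x))"
proof -
  have "tab (H y) m = rec_nat 0 (\<lambda>m c. prod_encode (G y m c, c)) m" for y m
    using H by (induction m) simp_all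
  then have "H y m = G y m (rec_nat 0 (\<lambda>m c. prod_encode (G y m c, c)) m)" for y m
    using H by simp
  moreover have "computable (\<lambda>x. G (a x) (b x) (rec_nat 0 (\<lambda>m c. prod_encode (G (a x) m c, c)) (b x)))"
    by (intro computable_comp3[OF G] computable_intros a b computable_comp[OF a])
  ultimately show ?thesis by simp
qed

section \<open>A uniform presentation of the c.e. sets\<close>

abbreviation prog_of :: "nat \<Rightarrow> prog" where "prog_of \<equiv> inv_into UNIV prog_encode"

lemma prog_of_encode [simp]: "prog_of (prog_encode p) = p"
  using bij_prog_encode by (simp add: bij_is_inj)

lemma prog_encode_prog_of [simp]: "prog_encode (prog_of e) = e"
  using bij_prog_encode by (simp add: bij_is_surj surj_f_inv_f)

text \<open>
  The fuel \<open>n\<close> bounds the arguments of all calls, so that for fixed \<open>n\<close> the behaviour of a program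
  is a finite table. The result 0 stands for an undefined value and \<open>Suc v\<close> for the value \<open>v\<close>.
\<close>

primrec bounded_eval :: "nat \<Rightarrow> prog \<Rightarrow> nat \<Rightarrow> nat" where
  "bounded_eval n Zero x = (if x \<le> n then 1 else 0)"
| "bounded_eval n Succ x = (if x \<le> n then Suc (Suc x) else 0)"
| "bounded_eval n Fst x = (if x \<le> n then Suc (pfst x) else 0)"
| "bounded_eval n Snd x = (if x \<le> n then Suc (psnd x) else 0)"
| "bounded_eval n (Tuple f g) x =
     (if x \<le> n \<and> 0 < bounded_eval n f x \<and> 0 < bounded_eval n g x
      then Suc (prod_encode (bounded_eval n f x - 1, bounded_eval n g x - 1)) else 0)"
| "bounded_eval n (Comp f g) x =
     (if x \<le> n \<and> 0 < bounded_eval n g x then bounded_eval n f (bounded_eval n g x - 1) else 0)"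
| "bounded_eval n (PrimRec f g) x =
     (if x \<le> n then rec_nat (bounded_eval n f (pfst x))
        (\<lambda>m r. if 0 < r then bounded_eval n g (prod_encode (pfst x, prod_encode (m, r - 1))) else 0)
        (psnd x)
      else 0)"
| "bounded_eval n (Mu f) x =
     (if x \<le> n \<and> bounded_eval n f (prod_encode (x, LEAST m. bounded_eval n f (prod_encode (x, m)) \<le> 1)) = 1
      then Suc (LEAST m. bounded_eval n f (prod_encode (x, m)) \<le> 1) else 0)"

lemma bounded_eval_eq_0: "n < x \<Longrightarrow> bounded_eval n p x = 0"
  by (cases p) auto

text \<open>The bounded search stops where \<open>f\<close> is undefined (0) or has value zero (1),
  and only the latter counts as success. Arguments above the fuel give 0, so it always
  stops.\<close>

lemma bounded_eval_Mu_eq_Suc_iff: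
  "bounded_eval n (Mu f) x = Suc v \<longleftrightarrow> x \<le> n \<and> bounded_eval n f (prod_encode (x, v)) = 1 \<and>
     (\<forall>m<v. 1 < bounded_eval n f (prod_encode (x, m)))"
proof -
  define P where "P = (\<lambda>m. bounded_eval n f (prod_encode (x, m)) \<le> 1)"
  have eq: "bounded_eval n (Mu f) x = (if x \<le> n \<and> bounded_eval n f (prod_encode (x, Least P)) = 1
      then Suc (Least P) else 0)"
    by (simp add: P_def)
  have "bounded_eval n (Mu f) x = Suc v \<longleftrightarrow>
      x \<le> n \<and> bounded_eval n f (prod_encode (x, v)) = 1 \<and> (\<forall>m<v. \<not> P m)"
  proof (intro iffI)
    assume "bounded_eval n (Mu f) x = Suc v"
    then have "Least P = v" "x \<le> n" "bounded_eval n f (prod_encode (x, Least P)) = 1"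
      unfolding eq by (metis Suc_inject nat.distinct(1))+
    then show "x \<le> n \<and> bounded_eval n f (prod_encode (x, v)) = 1 \<and> (\<forall>m<v. \<not> P m)"
      using not_less_Least by blast
  next
    assume v: "x \<le> n \<and> bounded_eval n f (prod_encode (x, v)) = 1 \<and> (\<forall>m<v. \<not> P m)"
    then have "P v" by (simp add: P_def)
    with v have "Least P = v" by (intro Least_equality) (auto simp: not_less[symmetric])
    with v show "bounded_eval n (Mu f) x = Suc v" by (simp only: eq simp_thms if_True)
  qed
  then show ?thesis by (simp only: P_def not_le)
qed

lemma bounded_eval_sound: "bounded_eval n p x = Suc v \<Longrightarrow> eval p x = Some v"
proof (induction p arbitrary: x v)
  case (Tuple f g)
  then show ?case by (fastforce split: if_splits simp: gr0_conv_Suc)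
next
  case (Comp f g)
  then show ?case by (fastforce split: if_splits simp: gr0_conv_Suc)
next
  case (PrimRec f g)
  let ?r = "rec_nat (bounded_eval n f (pfst x)) (\<lambda>m r. if 0 < r then
    bounded_eval n g (prod_encode (pfst x, prod_encode (m, r - 1))) else 0)"
  have "eval (PrimRec f g) (prod_encode (pfst x, k)) = Some u" if "?r k = Suc u" for k u
    using that
  proof (induction k arbitrary: u)
    case 0
    then show ?case using PrimRec.IH(1) by simp
  next
    case (Suc k)
    then obtain w where "?r k = Suc w" "bounded_eval n g (prod_encode (pfst x, prod_encode (k, w))) = Suc u"
      by (auto simp: gr0_conv_Suc split: if_splits)
    with Suc.IH[of w] PrimRec.IH(2) show ?case by (simp add: Let_def)
  qed
  from this[of "psnd x" v] PrimRec.prems show ?case by (simp add: Let_def split: if_splits)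
next
  case (Mu f)
  then show ?case
    unfolding bounded_eval_Mu_eq_Suc_iff eval_Mu_eq_Some_iff
    by (metis One_nat_def less_imp_Suc_add plus_1_eq_Suc add_Suc_right)
qed (auto split: if_splits)

lemma bounded_eval_mono:
  "bounded_eval n p x = Suc v \<Longrightarrow> n \<le> n' \<Longrightarrow> bounded_eval n' p x = Suc v"
proof (induction p arbitrary: x v)
  case (Tuple f g)
  then show ?case by (fastforce split: if_splits simp: gr0_conv_Suc)
next
  case (Comp f g)
  then show ?case by (fastforce split: if_splits simp: gr0_conv_Suc)
next
  case (PrimRec f g)
  let ?r = "\<lambda>n. rec_nat (bounded_eval n f (pfst x)) (\<lambda>m r. if 0 < r then
    bounded_eval n g (prod_encode (pfst x, prod_encode (m, r - 1))) else 0)"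
  have "?r n' k = Suc u" if "?r n k = Suc u" for k u
    using that
  proof (induction k arbitrary: u)
    case 0
    then show ?case using PrimRec.IH(1) PrimRec.prems(2) by simp
  next
    case (Suc k)
    then obtain w where "?r n k = Suc w" "bounded_eval n g (prod_encode (pfst x, prod_encode (k, w))) = Suc u"
      by (auto simp: gr0_conv_Suc split: if_splits)
    with Suc.IH[of w] PrimRec.IH(2) PrimRec.prems(2) show ?case by simp
  qed
  with PrimRec.prems show ?case by (simp split: if_splits)
next
  case (Mu f)
  then show ?case
    unfolding bounded_eval_Mu_eq_Suc_iff
    by (metis One_nat_def less_imp_Suc_add le_trans)
qed (auto split: if_splits)

text \<open>A halting computation makes finitely many calls. Monotonicity lets the fuels of the
  calls be replaced by their maximum, which also has to bound the argument \<open>x\<close>.\<close>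

lemma bounded_eval_complete: "eval p x = Some v \<Longrightarrow> \<exists>n. bounded_eval n p x = Suc v"
proof (induction p arbitrary: x v)
  case (Tuple f g)
  then obtain a b where ab: "eval f x = Some a" "eval g x = Some b" "v = prod_encode (a, b)"
    by (auto simp: bind_eq_Some_conv)
  with Tuple.IH obtain i j where "bounded_eval i f x = Suc a" "bounded_eval j g x = Suc b"
    by meson
  then have "bounded_eval (max x (max i j)) (Tuple f g) x = Suc v"
    using ab bounded_eval_mono[of i f x a "max x (max i j)"]
      bounded_eval_mono[of j g x b "max x (max i j)"] by simp
  then show ?case ..
next
  case (Comp f g)
  then obtain a where a: "eval g x = Some a" "eval f a = Some v"
    by (auto simp: bind_eq_Some_conv)
  with Comp.IH obtain i j where "bounded_eval i g x = Suc a" "bounded_eval j f a = Suc v"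
    by meson
  then have "bounded_eval (max x (max i j)) (Comp f g) x = Suc v"
    using bounded_eval_mono[of i g x a "max x (max i j)"]
      bounded_eval_mono[of j f a v "max x (max i j)"] by simp
  then show ?case ..
next
  case (PrimRec f g)
  let ?r = "\<lambda>n. rec_nat (bounded_eval n f (pfst x)) (\<lambda>m r. if 0 < r then
    bounded_eval n g (prod_encode (pfst x, prod_encode (m, r - 1))) else 0)"
  \<comment> \<open>The claim is made for all large fuels, since \<open>bounded_eval_mono\<close>
    covers programs but not the intermediate values \<open>?r n k\<close>.\<close>
  have "\<exists>i. \<forall>n\<ge>i. ?r n k = Suc u" if "eval (PrimRec f g) (prod_encode (pfst x, k)) = Some u" for k u
    using that
  proof (induction k arbitrary: u)
    case 0
    then have "eval f (pfst x) = Some u" by (simp add: Let_def)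
    with PrimRec.IH(1) obtain i where i: "bounded_eval i f (pfst x) = Suc u" by meson
    have "?r n 0 = Suc u" if "i \<le> n" for n
      using bounded_eval_mono[OF i that] by simp
    then show ?case by blast
  next
    case (Suc k)
    then obtain w where w: "eval (PrimRec f g) (prod_encode (pfst x, k)) = Some w"
      "eval g (prod_encode (pfst x, prod_encode (k, w))) = Some u"
      by (auto simp: Let_def bind_eq_Some_conv)
    with Suc.IH PrimRec.IH(2) obtain i j where ij: "\<And>n. i \<le> n \<Longrightarrow> ?r n k = Suc w"
      "bounded_eval j g (prod_encode (pfst x, prod_encode (k, w))) = Suc u"
      by meson
    have "?r n (Suc k) = Suc u" if "max i j \<le> n" for n
      using ij(1)[of n] bounded_eval_mono[OF ij(2), of n] that by simp
    then show ?case by blast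
  qed
  from this[of "psnd x" v] PrimRec.prems obtain i where "\<And>n. i \<le> n \<Longrightarrow> ?r n (psnd x) = Suc v"
    by (auto simp: Let_def)
  from this[of "max x i"] have "bounded_eval (max x i) (PrimRec f g) x = Suc v" by simp
  then show ?case ..
next
  case (Mu f)
  then have v: "eval f (prod_encode (x, v)) = Some 0"
    "\<And>m. m < v \<Longrightarrow> \<exists>w. eval f (prod_encode (x, m)) = Some (Suc w)"
    unfolding eval_Mu_eq_Some_iff by blast+
  \<comment> \<open>One fuel for all arguments below the zero found, collected by induction.\<close>
  have "\<exists>i. \<forall>m<k. 1 < bounded_eval i f (prod_encode (x, m))" if "k \<le> v" for k
    using that
  proof (induction k)
    case (Suc k)
    then obtain i where i: "\<And>m. m < k \<Longrightarrow> 1 < bounded_eval i f (prod_encode (x, m))" by auto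
    obtain w where "eval f (prod_encode (x, k)) = Some (Suc w)" using v(2)[of k] Suc.prems by auto
    with Mu.IH obtain j where j: "bounded_eval j f (prod_encode (x, k)) = Suc (Suc w)" by meson
    have "1 < bounded_eval (max i j) f (prod_encode (x, m))" if "m < Suc k" for m
    proof (cases "m = k")
      case True
      then show ?thesis using bounded_eval_mono[OF j, of "max i j"] by simp
    next
      case False
      then show ?thesis
        using i[of m] that bounded_eval_mono[of i f "prod_encode (x, m)" _ "max i j"]
        by (cases "bounded_eval i f (prod_encode (x, m))") auto
    qed
    then show ?case by blast
  qed simp
  then obtain i where i: "\<And>m. m < v \<Longrightarrow> 1 < bounded_eval i f (prod_encode (x, m))" by auto
  from v(1) Mu.IH obtain j where j: "bounded_eval j f (prod_encode (x, v)) = Suc 0" by meson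
  let ?n = "max x (max i j)"
  have "1 < bounded_eval ?n f (prod_encode (x, m))" if "m < v" for m
    using i[OF that] bounded_eval_mono[of i f "prod_encode (x, m)" _ ?n]
    by (cases "bounded_eval i f (prod_encode (x, m))") auto
  then have "bounded_eval ?n (Mu f) x = Suc v"
    using bounded_eval_mono[OF j, of ?n] unfolding bounded_eval_Mu_eq_Suc_iff by simp
  then show ?case ..
qed (fastforce)+

text \<open>A Kleene normal form: membership becomes a search over stages.\<close>

lemma mem_W_iff: "x \<in> W e \<longleftrightarrow> (\<exists>n. 0 < bounded_eval n (prog_of e) x)"
  unfolding W_def using bounded_eval_sound bounded_eval_complete
  by (fastforce simp: gr0_conv_Suc)

text \<open>One level of the interpreter, acting on codes: \<open>L\<close> supplies the behaviour
  of the programs with smaller codes. For \<open>e\<close> at least 4, \<open>k\<close> undoes the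
  arithmetic of \<open>prog_encode\<close>, and the residue of \<open>e\<close> modulo 4 tells the
  constructor.\<close>

definition bounded_eval_step :: "nat \<Rightarrow> nat \<Rightarrow> (nat \<Rightarrow> nat \<Rightarrow> nat) \<Rightarrow> nat \<Rightarrow> nat" where
  "bounded_eval_step n e L x =
    (let k = (e - 4) div 4; F = L (pfst k); G = L (psnd k); M = L k in
     if \<not> x \<le> n then 0
     else if e = 0 then 1
     else if e = 1 then Suc (Suc x)
     else if e = 2 then Suc (pfst x)
     else if e = 3 then Suc (psnd x)
     else if e mod 4 = 0 then
       if 0 < F x \<and> 0 < G x then Suc (prod_encode (F x - 1, G x - 1)) else 0
     else if e mod 4 = 1 then
       if 0 < G x then F (G x - 1) else 0
     else if e mod 4 = 2 then
       rec_nat (F (pfst x))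
         (\<lambda>m r. if 0 < r then G (prod_encode (pfst x, prod_encode (m, r - 1))) else 0) (psnd x)
     else if M (prod_encode (x, LEAST m. M (prod_encode (x, m)) \<le> 1)) = 1
       then Suc (LEAST m. M (prod_encode (x, m)) \<le> 1) else 0)"

lemma bounded_eval_step:
  assumes L: "\<And>i. i < prog_encode p \<Longrightarrow> L i = bounded_eval n (prog_of i)"
  shows "bounded_eval_step n (prog_encode p) L x = bounded_eval n p x"
proof -
  have less: "a < 4 * prod_encode (a, b) + 4 \<and> b < 4 * prod_encode (a, b) + 4" for a b
    using le_prod_encode_1[of a b] le_prod_encode_2[of b a] by linarith
  have arith: "Suc (4 * k) div 4 = k" "Suc (Suc (4 * k)) div 4 = k" "(4 * k + 2) div 4 = k"
    "(4 * k + 3) div 4 = k" "Suc (Suc (Suc (4 * k))) div 4 = k"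
    "(4 * k + 4) mod 4 = 0" "(4 * k + 5) mod 4 = 1" "(4 * k + 6) mod 4 = 2" "(4 * k + 7) mod 4 = 3"
    for k :: nat by presburger+
  show ?thesis
  proof (cases p)
    case (Tuple f g)
    have "L (prog_encode f) = bounded_eval n f" "L (prog_encode g) = bounded_eval n g"
      using less[of "prog_encode f" "prog_encode g"] by (simp_all add: L Tuple)
    then show ?thesis by (simp add: bounded_eval_step_def Tuple arith Let_def)
  next
    case (Comp f g)
    have "L (prog_encode f) = bounded_eval n f" "L (prog_encode g) = bounded_eval n g"
      using less[of "prog_encode f" "prog_encode g"] by (simp_all add: L Comp)
    then show ?thesis by (simp add: bounded_eval_step_def Comp arith Let_def)
  next
    case (PrimRec f g)
    have "L (prog_encode f) = bounded_eval n f" "L (prog_encode g) = bounded_eval n g"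
      using less[of "prog_encode f" "prog_encode g"] by (simp_all add: L PrimRec)
    then show ?thesis by (simp add: bounded_eval_step_def PrimRec arith Let_def cong: if_cong)
  next
    case (Mu f)
    have "L (prog_encode f) = bounded_eval n f"
      by (simp add: L Mu)
    then show ?thesis by (simp add: bounded_eval_step_def Mu arith Let_def cong: if_cong)
  qed (simp_all add: bounded_eval_step_def)
qed

text \<open>Course-of-values recursion on the program code, where the value at a code is the whole
  table of results for arguments up to the fuel. Larger arguments give 0, which is also the default
  of \<open>look\<close>, so this finite table is the full behaviour.\<close>

lemma computable_bounded_eval [computable_intros]:
  assumes n: "computable n" and e: "computable e" and a: "computable a"
  shows "computable (\<lambda>x. bounded_eval (n x) (prog_of (e x)) (a x))"
proof -
  define T where "T = (\<lambda>n e. tab (bounded_eval n (prog_of e)) (Suc n))"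
  define L where "L = (\<lambda>n e c i. look (Suc n) (look e c i))"
  have look_T: "look (Suc n) (T n e) = bounded_eval n (prog_of e)" for n e
    by (rule ext) (simp only: T_def look_tab, simp add: bounded_eval_eq_0)
  have "bounded_eval_step n e (L n e (tab (T n) e)) x = bounded_eval n (prog_of e) x" for n e x
    using bounded_eval_step[of "prog_of e" "L n e (tab (T n) e)" n x]
    by (simp add: L_def look_tab look_T)
  then have T: "T n e = tab (bounded_eval_step n e (L n e (tab (T n) e))) (Suc n)" for n e
    unfolding T_def by presburger
  \<comment> \<open>The search in the \<open>Mu\<close> case must succeed even for a
    \<open>c\<close> that is not a history; beyond the table \<open>look\<close> returns 0.\<close>
  have ex: "\<exists>m. look (Suc k) c (prod_encode (x, m)) \<le> 1" for k c x
    using le_prod_encode_2[of "Suc k" x] by (intro exI[of _ "Suc k"]) (simp add: look_def)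
  have "computable (\<lambda>x. T (n x) (e x))"
    by (rule computable_course_of_values[where H = T and
          G = "\<lambda>n e c. tab (bounded_eval_step n e (L n e c)) (Suc n)", OF _ T n e])
      (unfold bounded_eval_step_def Let_def L_def, intro computable_intros ex)
  then have "computable (\<lambda>x. look (Suc (n x)) (T (n x) (e x)) (a x))"
    by (intro computable_intros n a)
  then show ?thesis by (simp add: look_T)
qed

text \<open>A form of the s-m-n theorem: \<open>e\<close> is wired into a search program as a
  constant, and the code of that program is computable from \<open>e\<close>.\<close>

lemma uniform_ce:
  assumes P: "decidable (\<lambda>z. P (pfst z) (pfst (psnd z)) (psnd (psnd z)))"
  obtains h where "computable h" "\<And>e. W (h e) = {x. \<exists>n. P e x n}"
proof -
  \<comment> \<open>Reassociates the arguments, because \<open>Mu\<close> appends its search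
    variable to the pair of \<open>e\<close> and \<open>x\<close>.\<close>
  have "computable (\<lambda>z. if P (pfst (pfst z)) (psnd (pfst z)) (psnd z) then 0 else 1)"
    by (rule computable_comp3[where g = "\<lambda>e x n. if P e x n then 0 else 1",
          OF P[unfolded decidable_def]]) (intro computable_intros)+
  then obtain p where
    p: "\<And>z. eval p z = Some (if P (pfst (pfst z)) (psnd (pfst z)) (psnd z) then 0 else 1)"
    by (rule computableE) blast
  define const where "const = rec_nat Zero (\<lambda>_. Comp Succ)"
  have const: "eval (const k) x = Some k" for k x
    by (induction k) (simp_all add: const_def)
  \<comment> \<open>\<open>Tuple Fst Snd\<close> is the identity program.\<close>
  define q where "q e = Comp (Mu p) (Tuple (const e) (Tuple Fst Snd))" for e
  have code_const: "prog_encode (const k) =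
      rec_nat (prog_encode Zero) (\<lambda>_ c. 4 * prod_encode (prog_encode Succ, c) + 5) k" for k
    by (induction k) (simp_all add: const_def)
  have "computable (\<lambda>e. prog_encode (q e))"
    unfolding q_def prog_encode.simps(5,6) code_const by (intro computable_intros)
  moreover have "W (prog_encode (q e)) = {x. \<exists>n. P e x n}" for e
  proof -
    have "(\<exists>n. eval (q e) x = Some n) \<longleftrightarrow> (\<exists>n. P e x n)" for x
    proof -
      have "eval (q e) x = eval (Mu p) (prod_encode (e, x))"
        by (simp add: q_def const del: eval.simps(8))
      moreover have "eval (Mu p) (prod_encode (e, x)) = Some n \<longleftrightarrow> P e x n \<and> (\<forall>m<n. \<not> P e x m)" for n
        unfolding eval_Mu_eq_Some_iff p by auto
      moreover have "(\<exists>n. P e x n) \<longleftrightarrow> (\<exists>n. P e x n \<and> (\<forall>m<n. \<not> P e x m))"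
        by (rule exists_least_iff)
      ultimately show ?thesis by simp
    qed
    then show ?thesis by (simp add: W_def)
  qed
  ultimately show ?thesis by (rule that)
qed

section \<open>Congruences on the free commutative monoid of rank one\<close>

primrec exponent :: "trm \<Rightarrow> nat" where
  "exponent X0 = 1"
| "exponent Unit = 0"
| "exponent (Mult s t) = exponent s + exponent t"

primrec trm_pow :: "trm \<Rightarrow> nat \<Rightarrow> trm" where
  "trm_pow s 0 = Unit"
| "trm_pow s (Suc n) = Mult (trm_pow s n) s"

lemma exponent_trm_pow [simp]: "exponent (trm_pow s n) = n * exponent s"
  by (induction n) simp_all

text \<open>Transports the congruence from terms to the additive monoid of natural numbers.\<close>

definition exp_cong :: "(trm \<times> trm) set \<Rightarrow> nat \<Rightarrow> nat \<Rightarrow> bool" where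
  "exp_cong R m n \<longleftrightarrow> (trm_pow X0 m, trm_pow X0 n) \<in> gen_cong (R \<union> comm_monoid_laws)"

lemma gen_cong_laws:
  fixes R defines "C \<equiv> gen_cong (R \<union> comm_monoid_laws)"
  shows "(Mult (Mult s t) u, Mult s (Mult t u)) \<in> C"
    and "(Mult Unit s, s) \<in> C" "(Mult s Unit, s) \<in> C"
  unfolding C_def comm_monoid_laws_def by (rule gen_cong.base, blast)+

lemma trm_pow_add:
  "(Mult (trm_pow s m) (trm_pow s n), trm_pow s (m + n)) \<in> gen_cong (R \<union> comm_monoid_laws)"
proof (induction n)
  case 0
  show ?case by (simp add: gen_cong_laws)
next
  case (Suc n)
  have "(Mult (trm_pow s m) (Mult (trm_pow s n) s), Mult (Mult (trm_pow s m) (trm_pow s n)) s)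
      \<in> gen_cong (R \<union> comm_monoid_laws)"
    by (rule gen_cong.sym) (rule gen_cong_laws)
  moreover have "(Mult (Mult (trm_pow s m) (trm_pow s n)) s, Mult (trm_pow s (m + n)) s)
      \<in> gen_cong (R \<union> comm_monoid_laws)"
    using Suc gen_cong.refl by (rule gen_cong.mult)
  ultimately show ?case by (auto intro: gen_cong.trans)
qed

lemma gen_cong_normal_form: "(s, trm_pow X0 (exponent s)) \<in> gen_cong (R \<union> comm_monoid_laws)"
proof (induction s)
  case X0
  show ?case by (simp add: gen_cong.sym[OF gen_cong_laws(2)])
next
  case Unit
  show ?case by (simp add: gen_cong.refl)
next
  case (Mult s t)
  from gen_cong.trans[OF gen_cong.mult[OF Mult] trm_pow_add] show ?case by simp
qed

lemma gen_cong_iff_exp_cong: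
  "(s, t) \<in> gen_cong (R \<union> comm_monoid_laws) \<longleftrightarrow> exp_cong R (exponent s) (exponent t)"
  unfolding exp_cong_def using gen_cong_normal_form gen_cong.sym gen_cong.trans by meson

lemma exp_cong_base: "(s, t) \<in> R \<Longrightarrow> exp_cong R (exponent s) (exponent t)"
  using gen_cong.base[of "(s, t)" "R \<union> comm_monoid_laws"] by (simp add: gen_cong_iff_exp_cong)

lemma exp_cong_refl: "exp_cong R m m"
  by (simp add: exp_cong_def gen_cong.refl)

lemma exp_cong_sym: "exp_cong R m n \<Longrightarrow> exp_cong R n m"
  by (simp add: exp_cong_def gen_cong.sym)

lemma exp_cong_trans [trans]: "exp_cong R m n \<Longrightarrow> exp_cong R n k \<Longrightarrow> exp_cong R m k"
  unfolding exp_cong_def by (rule gen_cong.trans)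

lemma exp_cong_add:
  assumes "exp_cong R m n" "exp_cong R m' n'"
  shows "exp_cong R (m + m') (n + n')"
  using gen_cong.mult[OF assms[unfolded exp_cong_def]] by (simp add: gen_cong_iff_exp_cong)

lemma exp_cong_mult: "exp_cong R m n \<Longrightarrow> exp_cong R (m * k) (n * k)"
  by (induction k) (simp_all add: exp_cong_refl exp_cong_add)

lemma exp_cong_add_multiple:
  assumes "exp_cong R a (a + q)"
  shows "exp_cong R a (a + k * q)"
proof (induction k)
  case (Suc k)
  from exp_cong_add[OF Suc exp_cong_refl[of _ q]] have "exp_cong R (a + q) (a + Suc k * q)"
    by (simp add: algebra_simps)
  with assms show ?case by (rule exp_cong_trans)
qed (simp add: exp_cong_refl)

text \<open>Adding \<open>q\<close> repeatedly moves \<open>a\<close> to a congruent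
  \<open>N\<close> above \<open>u\<close>. There the relation between \<open>u\<close> and
  \<open>u + r\<close> applies after a shift, and the result is carried back to
  \<open>a\<close>.\<close>

lemma exp_cong_period_transfer:
  assumes q: "exp_cong R a (a + q)" "0 < q" and r: "exp_cong R u (u + r)"
  shows "exp_cong R a (a + r)"
proof -
  define N where "N = a + u * q"
  have "u \<le> N" using \<open>0 < q\<close> by (simp add: N_def trans_le_add2)
  with exp_cong_add[OF r exp_cong_refl[of _ "N - u"]] have N: "exp_cong R N (N + r)"
    by (simp add: algebra_simps)
  have a: "exp_cong R a N" unfolding N_def by (rule exp_cong_add_multiple[OF q(1)])
  then have "exp_cong R (N + r) (a + r)"
    by (rule exp_cong_sym[OF exp_cong_add[OF _ exp_cong_refl]])
  with a N show ?thesis by (meson exp_cong_trans)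
qed

lemma exp_cong_period_gcd:
  assumes "exp_cong R a (a + r)" "exp_cong R a (a + s)"
  shows "exp_cong R a (a + gcd r s)"
  using assms
proof (induction r s rule: gcd_nat_induct)
  case (step m n)
  have "exp_cong R (a + m mod n) (a + m div n * n + m mod n)"
    using step.prems(2) by (intro exp_cong_add exp_cong_refl exp_cong_add_multiple)
  then have "exp_cong R (a + m) (a + m mod n)"
    by (simp add: exp_cong_sym add.assoc)
  with step.prems(1) have "exp_cong R a (a + m mod n)" by (rule exp_cong_trans)
  with step show ?case by (simp add: gcd_red_nat[of m n])
qed simp

text \<open>
  The exponent congruence of the cyclic monoid of index \<open>a\<close> and period \<open>g\<close>. As \<open>m mod 0 = m\<close>, it is
  equality for \<open>g = 0\<close>.
\<close>

definition cyclic_cong :: "nat \<Rightarrow> nat \<Rightarrow> nat \<Rightarrow> nat \<Rightarrow> bool" where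
  "cyclic_cong a g m n \<longleftrightarrow> m = n \<or> a \<le> m \<and> a \<le> n \<and> m mod g = n mod g"

lemma cyclic_cong_0: "cyclic_cong a 0 = (=)"
  by (auto simp: cyclic_cong_def fun_eq_iff)

text \<open>The pair of \<open>a\<close> and \<open>a + g\<close> already decides this; as
  \<open>g\<close> is positive, it is not an instance of equality.\<close>

lemma cyclic_cong_le_imp:
  assumes "\<And>m n. cyclic_cong a g m n \<Longrightarrow> cyclic_cong a' g' m n" "0 < g"
  shows "a' \<le> a \<and> g' dvd g"
proof -
  have "cyclic_cong a g a (a + g)" by (simp add: cyclic_cong_def)
  with assms have "cyclic_cong a' g' a (a + g)" by blast
  with \<open>0 < g\<close> have "a' \<le> a" "(a + g) mod g' = a mod g'" by (auto simp: cyclic_cong_def)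
  then show ?thesis using mod_eq_dvd_iff_nat[of a "a + g" g'] by simp
qed

lemma cyclic_cong_eq_iff:
  assumes "0 < g" "0 < g'"
  shows "cyclic_cong a g = cyclic_cong a' g' \<longleftrightarrow> a = a' \<and> g = g'"
  using cyclic_cong_le_imp[of a g a' g'] cyclic_cong_le_imp[of a' g' a g] assms
  by (auto intro: dvd_antisym)

lemma cyclic_cong_neq_eq: "0 < g \<Longrightarrow> cyclic_cong a g \<noteq> (=)"
  using cyclic_cong_le_imp[of a g a 0] by (auto simp: cyclic_cong_0)

text \<open>One inclusion holds as \<open>cyclic_cong a g\<close> is a congruence containing the
  generators, the other as it is generated by the single pair of \<open>a\<close> and
  \<open>a + g\<close>.\<close>

lemma exp_cong_eq_cyclic_cong:
  assumes R: "\<And>s t. (s, t) \<in> R \<Longrightarrow> cyclic_cong a g (exponent s) (exponent t)"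
    and g: "exp_cong R a (a + g)"
  shows "exp_cong R = cyclic_cong a g"
proof (intro ext iffI)
  fix m n
  have "cyclic_cong a g (exponent (fst p)) (exponent (snd p))"
    if "p \<in> gen_cong (R \<union> comm_monoid_laws)" for p
    using that
  proof induction
    case (base p)
    then show ?case
      using R[of "fst p" "snd p"] by (auto simp: comm_monoid_laws_def cyclic_cong_def)
  next
    case (mult s s' t t')
    then show ?case by (auto simp: cyclic_cong_def intro: mod_add_cong)
  qed (auto simp: cyclic_cong_def)
  moreover assume "exp_cong R m n"
  ultimately show "cyclic_cong a g m n" by (fastforce simp: exp_cong_def)
next
  have *: "exp_cong R m n" if "m \<le> n" "a \<le> m" "m mod g = n mod g" for m n
  proof -
    from that have "g dvd n - m" using mod_eq_dvd_iff_nat[of m n g] by simp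
    then obtain k where "n - m = k * g" by (metis dvd_def mult.commute)
    with exp_cong_add[OF exp_cong_add_multiple[OF g, of k] exp_cong_refl[of _ "m - a"]] that
    show ?thesis by (simp add: algebra_simps) (metis le_add_diff_inverse)
  qed
  fix m n assume "cyclic_cong a g m n"
  then show "exp_cong R m n"
    using *[of m n] exp_cong_sym[OF *[of n m]] exp_cong_refl
    by (cases "m \<le> n") (auto simp: cyclic_cong_def)
qed

lemma exp_cong_eq_eq:
  assumes "\<And>s t. (s, t) \<in> R \<Longrightarrow> exponent s = exponent t"
  shows "exp_cong R = (=)"
  using exp_cong_eq_cyclic_cong[of R 0 0] assms
  by (simp add: cyclic_cong_0 exp_cong_refl)

section \<open>Isomorphism of quotients\<close>

lemma CM1_cong_iff: "(s, t) \<in> CM1_cong d e \<longleftrightarrow> exp_cong (d ` W e) (exponent s) (exponent t)"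
  unfolding CM1_cong_def by (rule gen_cong_iff_exp_cong)

lemma carrier_CM1: "carrier (CM1 d e) = range (\<lambda>s. CM1_cong d e `` {s})"
  by (auto simp: CM1_def quotient_def)

lemma CM1_nat_pow:
  "CM1_cong d e `` {s} [^]\<^bsub>CM1 d e\<^esub> (n :: nat) = CM1_cong d e `` {trm_pow s n}"
proof (induction n)
  case 0
  show ?case by (simp add: CM1_def)
next
  case (Suc n)
  then show ?case by (simp add: CM1_mult_class)
qed

text \<open>Every element is a power of the generator, so an identity between powers of the
  generator holds for all elements. The right-hand side does not mention the generator and is thus
  invariant under isomorphism.\<close>

lemma exp_cong_iff_nat_pow:
  "exp_cong (d ` W e) m n \<longleftrightarrow>
    (\<forall>z \<in> carrier (CM1 d e). z [^]\<^bsub>CM1 d e\<^esub> m = z [^]\<^bsub>CM1 d e\<^esub> n)"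
proof -
  have "(\<forall>z \<in> carrier (CM1 d e). z [^]\<^bsub>CM1 d e\<^esub> m = z [^]\<^bsub>CM1 d e\<^esub> n) \<longleftrightarrow>
      (\<forall>s. (trm_pow s m, trm_pow s n) \<in> CM1_cong d e)"
    by (simp add: carrier_CM1 CM1_nat_pow eq_equiv_class_iff[OF equiv_CM1_cong])
  also have "\<dots> \<longleftrightarrow> (\<forall>s. exp_cong (d ` W e) (m * exponent s) (n * exponent s))"
    by (simp add: CM1_cong_iff)
  also have "\<dots> \<longleftrightarrow> exp_cong (d ` W e) m n"
    using exp_cong_mult by (metis exponent.simps(1) mult.right_neutral)
  finally show ?thesis ..
qed

lemma iso_CM1_iff: "iso_CM1 d e i \<longleftrightarrow> exp_cong (d ` W e) = exp_cong (d ` W i)"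
proof
  assume "iso_CM1 d e i"
  then obtain f where f: "f \<in> iso (CM1 d e) (CM1 d i)" "f \<one>\<^bsub>CM1 d e\<^esub> = \<one>\<^bsub>CM1 d i\<^esub>"
    by (auto simp: iso_CM1_def)
  then have hom: "f \<in> hom (CM1 d e) (CM1 d i)"
    and inj: "inj_on f (carrier (CM1 d e))" and img: "f ` carrier (CM1 d e) = carrier (CM1 d i)"
    by (auto simp: iso_def bij_betw_def)
  have closed: "z [^]\<^bsub>CM1 d e\<^esub> n \<in> carrier (CM1 d e)" if "z \<in> carrier (CM1 d e)" for z and n :: nat
    using that by (auto simp: carrier_CM1 CM1_nat_pow)
  \<comment> \<open>Preservation of the identity constant gives the case
    \<open>n = 0\<close>.\<close>
  have pow: "f (z [^]\<^bsub>CM1 d e\<^esub> n) = f z [^]\<^bsub>CM1 d i\<^esub> n" if "z \<in> carrier (CM1 d e)"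
    for z and n :: nat
    by (induction n) (simp_all add: f(2) hom_mult[OF hom] closed that)
  have "z [^]\<^bsub>CM1 d e\<^esub> m = z [^]\<^bsub>CM1 d e\<^esub> n \<longleftrightarrow> f z [^]\<^bsub>CM1 d i\<^esub> m = f z [^]\<^bsub>CM1 d i\<^esub> n"
    if "z \<in> carrier (CM1 d e)" for z and m n :: nat
    using inj_on_eq_iff[OF inj closed[OF that] closed[OF that]] pow[OF that] by simp
  then show "exp_cong (d ` W e) = exp_cong (d ` W i)"
    unfolding fun_eq_iff exp_cong_iff_nat_pow img[symmetric] by simp
next
  assume "exp_cong (d ` W e) = exp_cong (d ` W i)"
  then have "CM1_cong d e = CM1_cong d i"
    by (auto simp: CM1_cong_iff)
  then have "CM1 d e = CM1 d i" by (simp add: CM1_def)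
  then show "iso_CM1 d e i"
    unfolding iso_CM1_def by (intro bexI[of _ "\<lambda>x. x"]) (auto simp: iso_def hom_def bij_betw_def)
qed

section \<open>The two reductions\<close>

abbreviation trm_of :: "nat \<Rightarrow> trm" where "trm_of \<equiv> inv_into UNIV trm_encode"

lemma trm_of_encode [simp]: "trm_of (trm_encode t) = t"
  using bij_trm_encode by (simp add: bij_is_inj)

text \<open>Course-of-values recursion on term codes: the factors of a product have smaller codes,
  recovered after removing the offset 2 of \<open>trm_encode\<close>.\<close>

lemma computable_exponent:
  assumes "computable a"
  shows "computable (\<lambda>x. exponent (trm_of (a x)))"
proof -
  have rec: "exponent (trm_of m) = (if m = 0 then 1 else if m = 1 then 0
      else look m (tab (\<lambda>n. exponent (trm_of n)) m) (pfst (m - 2))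
        + look m (tab (\<lambda>n. exponent (trm_of n)) m) (psnd (m - 2)))" for m
  proof -
    obtain t where t: "m = trm_encode t" using trm_encode_surj by metis
    show ?thesis
    proof (cases t)
      case (Mult u v)
      have "trm_encode u < m" "trm_encode v < m"
        using le_prod_encode_1[of "trm_encode u" "trm_encode v"]
          le_prod_encode_2[of "trm_encode v" "trm_encode u"] by (simp_all add: t Mult)
      moreover have "trm_of m = Mult u v" unfolding t Mult by (rule trm_of_encode)
      moreover have "m \<noteq> 0" "m \<noteq> 1" "prod_decode (m - 2) = (trm_encode u, trm_encode v)"
        by (simp_all add: t Mult)
      ultimately show ?thesis by (simp add: look_tab)
    next
      case X0
      have "trm_of m = X0" unfolding t X0 by (rule trm_of_encode)
      then show ?thesis by (simp add: t X0)
    next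
      case Unit
      have "trm_of m = Unit" unfolding t Unit by (rule trm_of_encode)
      then show ?thesis by (simp add: t Unit)
    qed
  qed
  show ?thesis
    by (rule computable_course_of_values[where H = "\<lambda>_ m. exponent (trm_of m)" and
          G = "\<lambda>_ m c. if m = 0 then 1 else if m = 1 then 0
            else look m c (pfst (m - 2)) + look m c (psnd (m - 2))", OF _ rec computable_const assms])
      (intro computable_intros)
qed

lemma computable_exponent_coding:
  assumes "computable_coding d" "computable a"
  shows "computable (\<lambda>x. exponent (fst (d (a x))))" "computable (\<lambda>x. exponent (snd (d (a x))))"
proof -
  have d: "computable (\<lambda>n. prod_encode (map_prod trm_encode trm_encode (d n)))"
    using assms by (simp add: computable_coding_def)
  have "computable (\<lambda>x. exponent (trm_of (pfst (prod_encode (map_prod trm_encode trm_encode (d (a x)))))))"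
    "computable (\<lambda>x. exponent (trm_of (psnd (prod_encode (map_prod trm_encode trm_encode (d (a x)))))))"
    by (intro computable_exponent computable_intros computable_comp[OF d assms(2)])+
  then show "computable (\<lambda>x. exponent (fst (d (a x))))" "computable (\<lambda>x. exponent (snd (d (a x))))"
    by simp_all
qed

lemma ex_prod_encode: "(\<exists>n. P n) \<longleftrightarrow> (\<exists>a b. P (prod_encode (a, b)))"
  by (metis prod_decode_inverse surj_pair)

text \<open>Ensures that the least code in a product of two sets is the code of the two
  minima.\<close>

lemma prod_encode_mono: "a \<le> a' \<Longrightarrow> b \<le> b' \<Longrightarrow> prod_encode (a, b) \<le> prod_encode (a', b')"
  unfolding prod_encode_def triangle_def
  by (simp del: mult_Suc mult_Suc_right) (intro add_mono div_le_mono mult_le_mono, auto)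

text \<open>The distance of \<open>m\<close> and \<open>n\<close>; at least one of the truncated
  differences is 0.\<close>

definition gap :: "nat \<Rightarrow> nat \<Rightarrow> nat" where
  "gap m n = (m - n) + (n - m)"

lemma dvd_gap_iff: "g dvd gap m n \<longleftrightarrow> m mod g = n mod g"
  using mod_eq_dvd_iff_nat[of m n g] mod_eq_dvd_iff_nat[of n m g]
  by (cases "m \<le> n") (auto simp: gap_def)

text \<open>A finite gcd, with value 0 if nothing is selected, written as a recursion so that
  \<open>computable_rec\<close> applies.\<close>

definition gcd_upto :: "(nat \<Rightarrow> bool) \<Rightarrow> (nat \<Rightarrow> nat) \<Rightarrow> nat \<Rightarrow> nat" where
  "gcd_upto A f n = rec_nat 0 (\<lambda>m r. if A m then gcd r (f m) else r) n"

lemma dvd_gcd_upto_iff: "k dvd gcd_upto A f n \<longleftrightarrow> (\<forall>m<n. A m \<longrightarrow> k dvd f m)"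
  by (induction n) (auto simp: gcd_upto_def less_Suc_eq)

lemma computable_gcd_upto:
  assumes "decidable (\<lambda>z. A (pfst z) (psnd z))" "computable f" "computable n"
  shows "computable (\<lambda>x. gcd_upto (A x) f (n x))"
proof -
  have A: "decidable (\<lambda>x. A (a x) (b x))" if "computable a" "computable b" for a b
    using computable_comp2[where g = "\<lambda>x y. if A x y then 0 else 1",
        OF assms(1)[unfolded decidable_def] that]
    by (simp add: decidable_def)
  show ?thesis
    unfolding gcd_upto_def by (intro computable_intros A assms computable_comp[OF assms(2)])
qed

text \<open>Lets a single minimum carry two invariants. The emptiness assumptions make the product
  empty exactly when its first factor is.\<close>

lemma E_min_prod_encode_iff:
  assumes We: "W e = {prod_encode (a, g) | a g. a \<in> I \<and> g \<in> G}"
    and Wi: "W i = {prod_encode (a, g) | a g. a \<in> I' \<and> g \<in> G'}"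
    and "I \<noteq> {} \<longleftrightarrow> G \<noteq> {}" "I' \<noteq> {} \<longleftrightarrow> G' \<noteq> {}"
  shows "E_min e i \<longleftrightarrow> I = {} \<and> I' = {} \<or> I \<noteq> {} \<and> I' \<noteq> {} \<and>
    (LEAST a. a \<in> I) = (LEAST a. a \<in> I') \<and> (LEAST g. g \<in> G) = (LEAST g. g \<in> G')"
proof -
  have least: "(LEAST x. x \<in> {prod_encode (a, g) | a g. a \<in> I \<and> g \<in> G}) =
      prod_encode (LEAST a. a \<in> I, LEAST g. g \<in> G)" if "I \<noteq> {}" "G \<noteq> {}" for I G
  proof (rule Least_equality)
    have "(LEAST a. a \<in> I) \<in> I" "(LEAST g. g \<in> G) \<in> G"
      using that by (metis LeastI ex_in_conv)+
    then show "prod_encode (LEAST a. a \<in> I, LEAST g. g \<in> G) \<in>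
        {prod_encode (a, g) | a g. a \<in> I \<and> g \<in> G}" by blast
  next
    fix x assume "x \<in> {prod_encode (a, g) | a g. a \<in> I \<and> g \<in> G}"
    then show "prod_encode (LEAST a. a \<in> I, LEAST g. g \<in> G) \<le> x"
      by (auto intro!: prod_encode_mono Least_le)
  qed
  have "W e = {} \<longleftrightarrow> I = {}" "W i = {} \<longleftrightarrow> I' = {}"
    unfolding We Wi using assms(3,4) by auto
  moreover have "(LEAST x. x \<in> W e) = prod_encode (LEAST a. a \<in> I, LEAST g. g \<in> G)" if "I \<noteq> {}"
    unfolding We using least that assms(3) by simp
  moreover have "(LEAST x. x \<in> W i) = prod_encode (LEAST a. a \<in> I', LEAST g. g \<in> G')" if "I' \<noteq> {}"
    unfolding Wi using least that assms(4) by simp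
  ultimately show ?thesis
    unfolding E_min_def by (cases "I = {}"; cases "I' = {}") simp_all
qed

section \<open>Index and period of the congruence presented by a c.e. set\<close>

context
  fixes d :: "nat \<Rightarrow> trm \<times> trm" and e :: nat
begin

definition nontrivial :: "nat \<Rightarrow> bool" where
  "nontrivial m \<longleftrightarrow> exponent (fst (d m)) \<noteq> exponent (snd (d m))"

definition indices :: "nat set" where
  "indices = {min (exponent (fst (d m))) (exponent (snd (d m))) | m. m \<in> W e \<and> nontrivial m}"

definition exp_gap :: "nat \<Rightarrow> nat" where
  "exp_gap m = gap (exponent (fst (d m))) (exponent (snd (d m)))"

definition stage_gcd :: "nat \<Rightarrow> nat" where
  "stage_gcd n = gcd_upto (\<lambda>m. 0 < bounded_eval n (prog_of e) m) exp_gap n"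

text \<open>A stage gcd of 0 means that no nontrivial pair has been found yet; it must not become
  the minimum.\<close>

definition periods :: "nat set" where
  "periods = {stage_gcd n | n. 0 < stage_gcd n}"

lemma dvd_stage_gcd_iff:
  "k dvd stage_gcd n \<longleftrightarrow> (\<forall>m<n. 0 < bounded_eval n (prog_of e) m \<longrightarrow> k dvd exp_gap m)"
  by (simp add: stage_gcd_def dvd_gcd_upto_iff)

lemma stage_gcd_antimono:
  assumes "n \<le> n'"
  shows "stage_gcd n' dvd stage_gcd n"
  unfolding dvd_stage_gcd_iff[of _ n]
proof (intro allI impI)
  fix m assume m: "m < n" "0 < bounded_eval n (prog_of e) m"
  then have "0 < bounded_eval n' (prog_of e) m"
    using bounded_eval_mono[OF _ assms] by (metis gr0_conv_Suc)
  with m assms show "stage_gcd n' dvd exp_gap m"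
    using dvd_stage_gcd_iff[of "stage_gcd n'" n'] by auto
qed

lemma stage_gcd_dvd_exp_gap:
  assumes "m \<in> W e"
  obtains n' where "\<And>n. n' \<le> n \<Longrightarrow> stage_gcd n dvd exp_gap m"
proof -
  from assms obtain n where n: "0 < bounded_eval n (prog_of e) m" by (auto simp: mem_W_iff)
  \<comment> \<open>Stage \<open>n\<close> only inspects codes below \<open>n\<close>, hence
    \<open>Suc m\<close>.\<close>
  let ?n = "max n (Suc m)"
  have "0 < bounded_eval ?n (prog_of e) m"
    using n bounded_eval_mono[of n _ m _ ?n] by (metis gr0_conv_Suc max.cobounded1)
  then have "stage_gcd ?n dvd exp_gap m"
    using dvd_stage_gcd_iff[of "stage_gcd ?n" ?n] by auto
  then show thesis using that stage_gcd_antimono dvd_trans by blast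
qed

lemma exp_gap_pos_iff: "0 < exp_gap m \<longleftrightarrow> nontrivial m"
  by (auto simp: exp_gap_def gap_def nontrivial_def)

text \<open>Either set is empty exactly when all enumerated pairs are trivial. A positive gap has
  only positive divisors, so a nontrivial pair forces a positive stage gcd.\<close>

lemma periods_empty_iff: "periods = {} \<longleftrightarrow> indices = {}"
proof -
  have "periods = {}" if "indices = {}"
  proof -
    have "exp_gap m = 0" if "m \<in> W e" for m
      using that \<open>indices = {}\<close> exp_gap_pos_iff[of m] by (auto simp: indices_def)
    then have "0 dvd stage_gcd n" for n
      unfolding dvd_stage_gcd_iff by (auto simp: mem_W_iff)
    then show ?thesis by (auto simp: periods_def)
  qed
  moreover have "indices = {}" if "periods = {}"
  proof -
    have "\<not> nontrivial m" if m: "m \<in> W e" for m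
    proof -
      from m obtain n where "stage_gcd n dvd exp_gap m" by (rule stage_gcd_dvd_exp_gap) blast
      then show ?thesis
        using \<open>periods = {}\<close> exp_gap_pos_iff[of m] by (auto simp: periods_def)
    qed
    then show ?thesis by (auto simp: indices_def)
  qed
  ultimately show ?thesis by blast
qed

text \<open>The stage gcds form a divisibility chain. From the stage that attains the least positive
  value on they stay constant, and each gap is divisible by all late ones.\<close>

lemma Least_periods_dvd_exp_gap:
  assumes "periods \<noteq> {}" "m \<in> W e"
  shows "(LEAST g. g \<in> periods) dvd exp_gap m"
proof -
  have least: "(LEAST g. g \<in> periods) \<in> periods"
    using assms(1) by (metis LeastI ex_in_conv)
  then obtain n where n: "(LEAST g. g \<in> periods) = stage_gcd n" "0 < stage_gcd n"
    by (auto simp: periods_def)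
  obtain n' where n': "\<And>n. n' \<le> n \<Longrightarrow> stage_gcd n dvd exp_gap m"
    using assms(2) by (rule stage_gcd_dvd_exp_gap) blast
  let ?k = "stage_gcd (max n n')"
  have k: "?k dvd stage_gcd n" by (rule stage_gcd_antimono) simp
  with n(2) have "0 < ?k" by (metis dvd_0_left gr0I)
  then have "stage_gcd n \<le> ?k"
    unfolding n(1)[symmetric] by (intro Least_le) (auto simp: periods_def)
  with k n(2) have "?k = stage_gcd n" by (simp add: dvd_imp_le le_antisym)
  then show ?thesis using n' n(1) by (metis max.cobounded2)
qed

lemma exp_cong_indices_empty:
  assumes "indices = {}"
  shows "exp_cong (d ` W e) = (=)"
proof (rule exp_cong_eq_eq)
  fix s t assume "(s, t) \<in> d ` W e"
  then obtain m where "m \<in> W e" "d m = (s, t)" by force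
  with assms show "exponent s = exponent t"
    by (force simp: indices_def nontrivial_def)
qed

text \<open>A nontrivial pair attaining the least index gives a positive period there. Period
  transfer makes every other gap a period at that index, and Euclid's algorithm adds all their
  gcds.\<close>

lemma exp_cong_eq_cyclic_cong_Least:
  assumes "indices \<noteq> {}"
  shows "exp_cong (d ` W e) = cyclic_cong (LEAST a. a \<in> indices) (LEAST g. g \<in> periods)"
proof (rule exp_cong_eq_cyclic_cong)
  let ?a = "LEAST a. a \<in> indices" and ?g = "LEAST g. g \<in> periods"
  have periods: "periods \<noteq> {}" using assms by (simp add: periods_empty_iff)
  fix s t assume "(s, t) \<in> d ` W e"
  then obtain m where m: "m \<in> W e" "d m = (s, t)" by force
  have "?a \<le> min (exponent s) (exponent t)" if "exponent s \<noteq> exponent t"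
  proof (rule Least_le)
    show "min (exponent s) (exponent t) \<in> indices"
      unfolding indices_def using m that by (intro CollectI exI[of _ m]) (simp add: nontrivial_def)
  qed
  moreover have "exponent s mod ?g = exponent t mod ?g"
    using Least_periods_dvd_exp_gap[OF periods m(1)] by (simp add: exp_gap_def m(2) dvd_gap_iff)
  ultimately show "cyclic_cong ?a ?g (exponent s) (exponent t)"
    by (auto simp: cyclic_cong_def)
next
  let ?a = "LEAST a. a \<in> indices" and ?g = "LEAST g. g \<in> periods"
  have pair: "exp_cong (d ` W e) u (u + exp_gap m)"
    if "m \<in> W e" "u = min (exponent (fst (d m))) (exponent (snd (d m)))" for m u
  proof -
    have base: "exp_cong (d ` W e) (exponent (fst (d m))) (exponent (snd (d m)))"
      using that(1) by (intro exp_cong_base) simp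
    show ?thesis
      using base exp_cong_sym[OF base] that(2)
      by (cases "exponent (fst (d m)) \<le> exponent (snd (d m))") (simp_all add: exp_gap_def gap_def min_def)
  qed
  have "?a \<in> indices" using assms by (metis LeastI ex_in_conv)
  then obtain m where m: "m \<in> W e" "nontrivial m"
    "?a = min (exponent (fst (d m))) (exponent (snd (d m)))"
    by (auto simp: indices_def)
  have gap: "exp_cong (d ` W e) ?a (?a + exp_gap k)" if "k \<in> W e" for k
    using m(2)
    by (intro exp_cong_period_transfer[OF pair[OF m(1,3)] _ pair[OF that HOL.refl]])
      (simp add: exp_gap_pos_iff)
  have upto: "exp_cong (d ` W e) ?a (?a + gcd_upto A exp_gap n)" if "\<And>k. A k \<Longrightarrow> k \<in> W e" for A n
    by (induction n) (simp_all add: gcd_upto_def exp_cong_refl exp_cong_period_gcd gap that)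
  have stage: "exp_cong (d ` W e) ?a (?a + stage_gcd n)" for n
    unfolding stage_gcd_def by (rule upto) (auto simp: mem_W_iff)
  have "?g \<in> periods" using assms periods_empty_iff by (metis LeastI ex_in_conv)
  then show "exp_cong (d ` W e) ?a (?a + ?g)"
    using stage by (auto simp: periods_def)
qed

lemma Least_periods_pos: "periods \<noteq> {} \<Longrightarrow> 0 < (LEAST g. g \<in> periods)"
proof -
  assume "periods \<noteq> {}"
  then have "(LEAST g. g \<in> periods) \<in> periods" by (metis LeastI ex_in_conv)
  then show ?thesis by (auto simp: periods_def)
qed

end

section \<open>The reductions to and from \<open>E_min\<close>\<close>

lemma iso_CM1_reducible:
  assumes "computable_coding d"
  shows "iso_CM1 d \<le>\<^sub>c E_min"
proof -
  note computable_d = computable_exponent_coding[OF assms]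
  have stage: "computable (\<lambda>x. stage_gcd d (a x) (b x))" if "computable a" "computable b" for a b
  proof -
    have "computable (\<lambda>z. stage_gcd d (pfst z) (psnd z))"
      unfolding stage_gcd_def
      by (intro computable_gcd_upto computable_intros)
        (unfold exp_gap_def gap_def, intro computable_intros computable_d)
    from computable_comp2[where g = "stage_gcd d", OF this that] show ?thesis .
  qed
  \<comment> \<open>The witness \<open>n\<close> codes a fuel, a generating pair and a stage. The
    pair fixes the index and the stage fixes the period, independently, so the enumerated set is a
    full product.\<close>
  define P where "P = (\<lambda>e x n.
    0 < bounded_eval (pfst n) (prog_of e) (pfst (psnd n)) \<and> nontrivial d (pfst (psnd n)) \<and>
    pfst x = min (exponent (fst (d (pfst (psnd n))))) (exponent (snd (d (pfst (psnd n))))) \<and>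
    psnd x = stage_gcd d e (psnd (psnd n)) \<and> 0 < psnd x)"
  have "decidable (\<lambda>z. P (pfst z) (pfst (psnd z)) (psnd (psnd z)))"
    unfolding P_def nontrivial_def by (intro computable_intros computable_d stage)
  then obtain h where h: "computable h" "\<And>e. W (h e) = {x. \<exists>n. P e x n}"
    by (rule uniform_ce) blast
  have W_h: "W (h e) = {prod_encode (a, g) | a g. a \<in> indices d e \<and> g \<in> periods d e}" for e
  proof (rule Set.set_eqI)
    fix x
    obtain a g where x: "x = prod_encode (a, g)" by (metis prod_decode_inverse surj_pair)
    have "x \<in> W (h e) \<longleftrightarrow> (\<exists>i k. P e x (prod_encode (i, k)))"
      unfolding h mem_Collect_eq by (rule ex_prod_encode)
    also have "\<dots> \<longleftrightarrow> (\<exists>i m j. P e x (prod_encode (i, prod_encode (m, j))))"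
      by (rule ex_cong1, rule ex_prod_encode)
    also have "\<dots> \<longleftrightarrow> a \<in> indices d e \<and> g \<in> periods d e"
      by (auto simp: P_def x indices_def periods_def mem_W_iff)
    finally show "x \<in> W (h e) \<longleftrightarrow> x \<in> {prod_encode (a, g) | a g. a \<in> indices d e \<and> g \<in> periods d e}"
      by (auto simp: x)
  qed
  have "iso_CM1 d e i \<longleftrightarrow> E_min (h e) (h i)" for e i
  proof -
    have "E_min (h e) (h i) \<longleftrightarrow> exp_cong (d ` W e) = exp_cong (d ` W i)"
      using E_min_prod_encode_iff[OF W_h[of e] W_h[of i]]
      by (cases "indices d e = {}"; cases "indices d i = {}")
        (auto simp: periods_empty_iff exp_cong_indices_empty exp_cong_eq_cyclic_cong_Least
          cyclic_cong_eq_iff Least_periods_pos cyclic_cong_neq_eq cyclic_cong_neq_eq[symmetric])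
    then show ?thesis by (simp add: iso_CM1_iff)
  qed
  with h(1) show ?thesis unfolding reducible_c_def by blast
qed

lemma E_min_reducible:
  assumes "computable_coding d"
  shows "E_min \<le>\<^sub>c iso_CM1 d"
proof -
  define P where "P = (\<lambda>e x n. exponent (snd (d x)) = Suc (exponent (fst (d x))) \<and>
    0 < bounded_eval n (prog_of e) (exponent (fst (d x))))"
  have "decidable (\<lambda>z. P (pfst z) (pfst (psnd z)) (psnd (psnd z)))"
    unfolding P_def by (intro computable_intros computable_exponent_coding[OF assms])
  then obtain h where h: "computable h" "\<And>e. W (h e) = {x. \<exists>n. P e x n}"
    by (rule uniform_ce) blast
  have W_h: "W (h e) = {x. exponent (snd (d x)) = Suc (exponent (fst (d x))) \<and> exponent (fst (d x)) \<in> W e}" for e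
    unfolding h P_def mem_W_iff by auto
  have empty: "exp_cong (d ` W (h e)) = (=)" if "W e = {}" for e
    using that by (intro exp_cong_eq_eq) (simp add: W_h)
  have nonempty: "exp_cong (d ` W (h e)) = cyclic_cong (LEAST m. m \<in> W e) 1" if "W e \<noteq> {}" for e
  proof (rule exp_cong_eq_cyclic_cong)
    fix s t assume "(s, t) \<in> d ` W (h e)"
    then obtain x where "x \<in> W (h e)" "d x = (s, t)" by force
    then have "exponent t = Suc (exponent s)" "exponent s \<in> W e" by (simp_all add: W_h)
    then show "cyclic_cong (LEAST m. m \<in> W e) 1 (exponent s) (exponent t)"
      using Least_le[of "\<lambda>m. m \<in> W e" "exponent s"] by (simp add: cyclic_cong_def)
  next
    let ?m = "LEAST m. m \<in> W e"
    have "?m \<in> W e" using that by (metis LeastI ex_in_conv)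
    \<comment> \<open>Surjectivity of \<open>d\<close> provides a code for this pair.\<close>
    moreover obtain x where x: "d x = (trm_pow X0 ?m, trm_pow X0 (Suc ?m))"
      using assms unfolding computable_coding_def by (metis bij_pointE)
    ultimately have "x \<in> W (h e)" by (simp add: W_h)
    with x have "(trm_pow X0 ?m, trm_pow X0 (Suc ?m)) \<in> d ` W (h e)" by (metis imageI)
    from exp_cong_base[OF this] show "exp_cong (d ` W (h e)) ?m (?m + 1)" by simp
  qed
  have "E_min e i \<longleftrightarrow> iso_CM1 d (h e) (h i)" for e i
    unfolding iso_CM1_iff E_min_def
    by (cases "W e = {}"; cases "W i = {}")
      (auto simp: empty nonempty cyclic_cong_eq_iff cyclic_cong_neq_eq cyclic_cong_neq_eq[symmetric])
  with h(1) show ?thesis unfolding reducible_c_def by blast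
qed

theorem theorem3p5:
  fixes d :: "nat \<Rightarrow> trm \<times> trm"
  assumes "computable_coding d"
  shows "iso_CM1 d \<equiv>\<^sub>c E_min"
  using iso_CM1_reducible[OF assms] E_min_reducible[OF assms] by (simp add: bireducible_c_def)

end
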